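(* Let $X,Y$ be two compact topological spaces endowed with two continuous functions $\vec\varphi:X\to\mathbb{R}^n$, $\vec\psi:Y\to\mathbb{R}^n$. Let $k\in\mathbb{Z}$ and let homology coefficients be taken in an Abelian group $G$. Then $$d_T\left(H_k^{(X,\vec\varphi)},H_k^{(Y,\vec\psi)}\right)\le\delta\left((X,\vec\varphi),(Y,\vec\psi)\right).$$
   Context: For $\vec u,\vec v\in\mathbb{R}^n$ write $\vec u\preceq\vec v$ (resp. $\vec u\prec\vec v$) if $u_i\le v_i$ (resp. $u_i<v_i$) for all $i$. Let $\Delta^+=\{(\vec u,\vec v)\in\mathbb{R}^n\times\mathbb{R}^n:\vec u\prec\vec v\}$. For a function $\vec\varphi:X\to\mathbb{R}^n$ put $X\langle\vec\varphi\preceq\vec u\rangle=\{x\in X:\varphi_i(x)\le u_i,\ i=1,\dots,n\}$. $\mathbb{R}^n$ carries the max-norm $\|\vec u\|_\infty=\max_i|u_i|$, and for $X$ compact and $\vec\varphi$ continuous, $\|\vec\varphi\|_\infty=\max_{x\in X}\|\vec\varphi(x)\|_\infty$. Persistent homology group: $H_k$ denotes $k$th (singular) homology with coefficients in $G$. For $(\vec u,\vec v)\in\Delta^+$, $H_k^{(X,\vec\varphi)}(\vec u,\vec v)$ is the image of the homomorphism $H_k(X\langle\vec\varphi\preceq\vec u\rangle)\to H_k(X\langle\vec\varphi\preceq\vec v\rangle)$ induced by inclusion; $H_k^{(X,\vec\varphi)}$ denotes the function $(\vec u,\vec v)\mapsto H_k^{(X,\vec\varphi)}(\vec u,\vec v)$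 on $\Delta^+$. Definition of $d_T$: let $E$ be the set of all real $\epsilon\ge 0$ such that, with $\vec\epsilon=(\epsilon,\dots,\epsilon)\in\mathbb{R}^n$, for every $(\vec u,\vec v)\in\Delta^+$: (1) there is a surjective homomorphism from a subgroup of $H_k^{(X,\vec\varphi)}(\vec u,\vec v)$ onto $H_k^{(Y,\vec\psi)}(\vec u-\vec\epsilon,\vec v+\vec\epsilon)$; and (2) there is a surjective homomorphism from a subgroup of $H_k^{(Y,\vec\psi)}(\vec u,\vec v)$ onto $H_k^{(X,\vec\varphi)}(\vec u-\vec\epsilon,\vec v+\vec\epsilon)$. Then $d_T\left(H_k^{(X,\vec\varphi)},H_k^{(Y,\vec\psi)}\right)=\inf E$ if $E\neq\emptyset$, and $=\infty$ otherwise. Natural pseudo-distance: $\delta\left((X,\vec\varphi),(Y,\vec\psi)\right)=\inf_h\|\vec\varphi-\vec\psi\circ h\|_\infty$, where $h$ varies over all homeomorphisms from $X$ to $Y$, if $X$ and $Y$ are homeomorphic; and $=\infty$ if $X$ and $Y$ are not homeomorphic. *)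

theory Defs
  imports "HOL-Analysis.Analysis" "HOL-Homology.Homology"
begin

section \<open>Singular homology with coefficients in an abelian group\<close>

text \<open>
  \<open>HOL-Homology\<close> only treats integer coefficients, so singular homology with coefficients in a
  (multiplicatively written) abelian group \<open>G\<close> is built here on top of its singular simplices, faces
  and simplex maps. A \<open>p\<close>-chain is an element of the direct sum of copies of \<open>G\<close> indexed by the
  singular \<open>p\<close>-simplices of \<open>X\<close>, i.e. a finitely supported \<open>G\<close>-valued function \<open>c\<close> on these
  simplices, read as the formal sum of all terms \<open>c \<sigma> \<cdot> \<sigma>\<close>.
\<close>

definition coeff_chain_group ::
    "('g, 'm) monoid_scheme \<Rightarrow> nat \<Rightarrow> 'a topology \<Rightarrow> (((nat \<Rightarrow> real) \<Rightarrow> 'a) \<Rightarrow> 'g) monoid" where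
  "coeff_chain_group G p X = sum_group (singular_simplex_set p X) (\<lambda>_. G)"

text \<open>
  The \<open>G\<close>-linear extension of a map \<open>m\<close> from \<open>A\<close> to \<open>B\<close>, sending \<open>g \<cdot> \<sigma>\<close> to \<open>g \<cdot> m \<sigma>\<close>: the new
  coefficient of \<open>\<tau>\<close> is the \<open>G\<close>-sum of the nontrivial coefficients of all \<open>\<sigma>\<close> mapped to \<open>\<tau>\<close>.
\<close>

definition coeff_extend ::
    "('g, 'm) monoid_scheme \<Rightarrow> ('s \<Rightarrow> 't) \<Rightarrow> 's set \<Rightarrow> 't set \<Rightarrow> ('s \<Rightarrow> 'g) \<Rightarrow> ('t \<Rightarrow> 'g)" where
  "coeff_extend G m A B c =
     (\<lambda>\<tau>\<in>B. finprod G c {\<sigma> \<in> A. m \<sigma> = \<tau> \<and> c \<sigma> \<noteq> \<one>\<^bsub>G\<^esub>})"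

text \<open>
  As for \<^const>\<open>chain_boundary\<close>, the boundary of a 0-chain is declared to be trivial (with the junk
  target \<open>p - 1 = 0\<close>).
\<close>

definition coeff_boundary ::
    "('g, 'm) monoid_scheme \<Rightarrow> nat \<Rightarrow> 'a topology \<Rightarrow>
      (((nat \<Rightarrow> real) \<Rightarrow> 'a) \<Rightarrow> 'g) \<Rightarrow> (((nat \<Rightarrow> real) \<Rightarrow> 'a) \<Rightarrow> 'g)" where
  "coeff_boundary G p X c =
     (if p = 0 then \<one>\<^bsub>coeff_chain_group G (p - 1) X\<^esub>
      else finprod (coeff_chain_group G (p - 1) X)
             (\<lambda>i. coeff_extend G (singular_face p i)
                     (singular_simplex_set p X) (singular_simplex_set (p - 1) X) c
                   [^]\<^bsub>coeff_chain_group G (p - 1) X\<^esub> ((-1) ^ i :: int))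
             {..p})"

definition coeff_cycles ::
    "('g, 'm) monoid_scheme \<Rightarrow> nat \<Rightarrow> 'a topology \<Rightarrow> (((nat \<Rightarrow> real) \<Rightarrow> 'a) \<Rightarrow> 'g) set" where
  "coeff_cycles G p X =
     kernel (coeff_chain_group G p X) (coeff_chain_group G (p - 1) X) (coeff_boundary G p X)"

definition coeff_boundaries ::
    "('g, 'm) monoid_scheme \<Rightarrow> nat \<Rightarrow> 'a topology \<Rightarrow> (((nat \<Rightarrow> real) \<Rightarrow> 'a) \<Rightarrow> 'g) set" where
  "coeff_boundaries G p X =
     coeff_boundary G (Suc p) X ` carrier (coeff_chain_group G (Suc p) X)"

text \<open>In negative degrees the group is trivial, with the same convention as in \<open>HOL-Homology\<close>.\<close>

definition coeff_homology_group ::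
    "('g, 'm) monoid_scheme \<Rightarrow> int \<Rightarrow> 'a topology \<Rightarrow> (((nat \<Rightarrow> real) \<Rightarrow> 'a) \<Rightarrow> 'g) set monoid" where
  "coeff_homology_group G k X =
     (if k < 0 then singleton_group undefined
      else (coeff_chain_group G (nat k) X)\<lparr>carrier := coeff_cycles G (nat k) X\<rparr>
             Mod coeff_boundaries G (nat k) X)"

definition coeff_chain_map ::
    "('g, 'm) monoid_scheme \<Rightarrow> nat \<Rightarrow> 'a topology \<Rightarrow> 'b topology \<Rightarrow> ('a \<Rightarrow> 'b) \<Rightarrow>
      (((nat \<Rightarrow> real) \<Rightarrow> 'a) \<Rightarrow> 'g) \<Rightarrow> (((nat \<Rightarrow> real) \<Rightarrow> 'b) \<Rightarrow> 'g)" where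
  "coeff_chain_map G p X Y f =
     coeff_extend G (simplex_map p f) (singular_simplex_set p X) (singular_simplex_set p Y)"

text \<open>
  The induced homomorphism sends the homology class \<open>B X + z\<close> of a cycle \<open>z\<close> to the class
  \<open>B Y + f z\<close>. As \<open>f\<close> maps boundaries to boundaries, this class is the sum of the set \<open>B Y\<close> and the
  image under \<open>f\<close> of the whole class \<open>B X + z\<close>, which avoids choosing a representative.
\<close>

definition coeff_hom_induced ::
    "('g, 'm) monoid_scheme \<Rightarrow> int \<Rightarrow> 'a topology \<Rightarrow> 'b topology \<Rightarrow> ('a \<Rightarrow> 'b) \<Rightarrow>
      (((nat \<Rightarrow> real) \<Rightarrow> 'a) \<Rightarrow> 'g) set \<Rightarrow> (((nat \<Rightarrow> real) \<Rightarrow> 'b) \<Rightarrow> 'g) set" where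
  "coeff_hom_induced G k X Y f z =
     (if k < 0 then undefined
      else coeff_boundaries G (nat k) Y
             <#>\<^bsub>coeff_chain_group G (nat k) Y\<^esub> (coeff_chain_map G (nat k) X Y f ` z))"


section \<open>Multidimensional persistent homology groups\<close>

text \<open>
  On \<^typ>\<open>real ^ 'n\<close> the library order \<open>\<le>\<close> is componentwise, but \<open>u < v\<close> only means
  \<open>u \<le> v \<and> u \<noteq> v\<close>; the strict relation in every component is a separate notion.
\<close>

definition strictly_below :: "real ^ 'n \<Rightarrow> real ^ 'n \<Rightarrow> bool" (infix \<open>\<prec>\<close> 50) where
  "u \<prec> v \<longleftrightarrow> (\<forall>i. u $ i < v $ i)"

definition sublevel :: "'a topology \<Rightarrow> ('a \<Rightarrow> real ^ 'n) \<Rightarrow> real ^ 'n \<Rightarrow> 'a topology" where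
  "sublevel X \<phi> u = subtopology X {x \<in> topspace X. \<phi> x \<le> u}"

definition persistent_homology ::
    "('g, 'm) monoid_scheme \<Rightarrow> int \<Rightarrow> 'a topology \<Rightarrow> ('a \<Rightarrow> real ^ 'n) \<Rightarrow>
      real ^ 'n \<Rightarrow> real ^ 'n \<Rightarrow> (((nat \<Rightarrow> real) \<Rightarrow> 'a) \<Rightarrow> 'g) set monoid" where
  "persistent_homology G k X \<phi> u v =
     (coeff_homology_group G k (sublevel X \<phi> v))
       \<lparr>carrier := coeff_hom_induced G k (sublevel X \<phi> u) (sublevel X \<phi> v) id
                     ` carrier (coeff_homology_group G k (sublevel X \<phi> u))\<rparr>"


section \<open>The two distances\<close>

definition subgroup_surjects ::
    "('a, 'm) monoid_scheme \<Rightarrow> ('b, 'n) monoid_scheme \<Rightarrow> bool" where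
  "subgroup_surjects A B \<longleftrightarrow> (\<exists>S f. subgroup S A \<and> f \<in> epi (A\<lparr>carrier := S\<rparr>) B)"

text \<open>The infimum is taken in \<^typ>\<open>ennreal\<close>, so it is \<open>\<infinity>\<close> when no \<open>\<epsilon>\<close> is admissible.\<close>

definition dist_T ::
    "(real ^ 'n \<Rightarrow> real ^ 'n \<Rightarrow> ('a, 'k) monoid_scheme) \<Rightarrow>
     (real ^ 'n \<Rightarrow> real ^ 'n \<Rightarrow> ('b, 'l) monoid_scheme) \<Rightarrow> ennreal" where
  "dist_T H K =
     (INF \<epsilon> \<in> {\<epsilon>::real. 0 \<le> \<epsilon> \<and>
                 (\<forall>u v. u \<prec> v \<longrightarrow>
                    subgroup_surjects (H u v) (K (u - (\<chi> i. \<epsilon>)) (v + (\<chi> i. \<epsilon>))) \<and>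
                    subgroup_surjects (K u v) (H (u - (\<chi> i. \<epsilon>)) (v + (\<chi> i. \<epsilon>))))}.
        ennreal \<epsilon>)"

text \<open>
  On \<^typ>\<open>real ^ 'n\<close>, \<^const>\<open>infnorm\<close> is the max-norm. For continuous functions on a nonempty compact
  space the supremum is a maximum; on the empty space it is \<open>0\<close>.
\<close>

definition sup_norm :: "'a topology \<Rightarrow> ('a \<Rightarrow> real ^ 'n) \<Rightarrow> ennreal" where
  "sup_norm X f = (SUP x \<in> topspace X. ennreal (infnorm (f x)))"

text \<open>If the spaces are not homeomorphic, the infimum is over the empty set and equals \<open>\<infinity>\<close>.\<close>

definition natural_pseudodistance ::
    "'a topology \<Rightarrow> ('a \<Rightarrow> real ^ 'n) \<Rightarrow> 'b topology \<Rightarrow> ('b \<Rightarrow> real ^ 'n) \<Rightarrow> ennreal" where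
  "natural_pseudodistance X \<phi> Y \<psi> =
     (INF h \<in> {h. homeomorphic_map X Y h}. sup_norm X (\<lambda>x. \<phi> x - \<psi> (h x)))"

end

theory Submission
  imports Defs
begin

text \<open>Fix a homeomorphism \<open>f\<close> from \<open>X\<close> to \<open>Y\<close> with
  inverse \<open>g\<close>, and let \<epsilon> be the sup norm of the difference between \<phi> and
  the composite of \<psi> with \<open>f\<close>; only a finite value matters. Values at
  corresponding points differ by at most \<epsilon> in each component, so \<open>f\<close> maps the
  sublevel set of \<open>X\<close> at u - \<epsilon> into that of \<open>Y\<close> at u, and
  \<open>g\<close> maps the sublevel set of \<open>Y\<close> at v into that of \<open>X\<close> at v
  + \<epsilon>. Thus the inclusion of the two sublevel sets of \<open>X\<close> is \<open>f\<close>,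
  followed by the inclusion of those of \<open>Y\<close>, followed by \<open>g\<close>.

  In homology, the classes coming from the lower sublevel set of \<open>X\<close> form a subgroup of
  the persistent group of \<open>Y\<close> at (u, v), and \<open>g\<close> carries this subgroup
  onto the persistent group of \<open>X\<close> at (u - \<epsilon>, v + \<epsilon>). This is
  \<open>subgroup_surjects_persistent_homology\<close>. Exchanging the two spaces gives the other
  condition, so \<epsilon> is admissible for \<open>dist_T\<close>; the infimum over
  \<open>f\<close> gives the bound.

  The surjection rests on functoriality of chains with coefficients
  (\<open>coeff_extend_hom\<close>, \<open>coeff_extend_compose\<close>,
  \<open>coeff_chain_map_boundary\<close>) and on \<open>coeff_hom_induced_coset\<close>, which
  evaluates the induced map on a representative.\<close>

section \<open>Homomorphisms of abelian groups, finite products and cosets\<close>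

lemma hom_finprod:
  assumes "comm_group C" "comm_group D" "f \<in> hom C D" "g \<in> A \<rightarrow> carrier C"
  shows "f (finprod C g A) = finprod D (\<lambda>x. f (g x)) A"
proof -
  interpret C: comm_group C by fact
  interpret D: comm_group D by fact
  interpret f: group_hom C D f
    using assms by unfold_locales (auto simp: group_hom_axioms_def)
  show ?thesis
    using assms(4)
  \<comment> \<open>A product over an infinite set is \<one> by convention, so that case is
    preservation of the identity.\<close>
  proof (induction A rule: infinite_finite_induct)
    case (insert a A)
    then have "g a \<in> carrier C" "g \<in> A \<rightarrow> carrier C" "(\<lambda>x. f (g x)) \<in> A \<rightarrow> carrier D"
      by (auto simp: Pi_iff)
    with insert show ?case by simp
  qed auto
qed

text \<open>Commutativity of the target allows factors to be regrouped. With
  \<open>int_pow_in_hom\<close> this makes the alternating sum of faces a homomorphism.\<close>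

lemma finprod_in_hom:
  assumes "comm_group D" "\<And>i. i \<in> A \<Longrightarrow> h i \<in> hom C D"
  shows "(\<lambda>c. finprod D (\<lambda>i. h i c) A) \<in> hom C D"
proof -
  interpret D: comm_group D by fact
  have mem: "h i c \<in> carrier D" if "i \<in> A" "c \<in> carrier C" for i c
    using assms(2) that by (auto simp: hom_def)
  show ?thesis
  proof (rule homI)
    fix x y assume xy: "x \<in> carrier C" "y \<in> carrier C"
    then have "finprod D (\<lambda>i. h i (x \<otimes>\<^bsub>C\<^esub> y)) A = finprod D (\<lambda>i. h i x \<otimes>\<^bsub>D\<^esub> h i y) A"
      using assms(2) mem by (intro D.finprod_cong') (auto simp: hom_mult)
    also have "\<dots> = finprod D (\<lambda>i. h i x) A \<otimes>\<^bsub>D\<^esub> finprod D (\<lambda>i. h i y) A"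
      using xy mem by (intro D.finprod_multf) auto
    finally show "finprod D (\<lambda>i. h i (x \<otimes>\<^bsub>C\<^esub> y)) A = \<dots>" .
  qed (use mem in auto)
qed

lemma int_pow_in_hom:
  assumes "comm_group D" "h \<in> hom C D"
  shows "(\<lambda>c. h c [^]\<^bsub>D\<^esub> (k::int)) \<in> hom C D"
proof -
  interpret D: comm_group D by fact
  show ?thesis
    using assms(2) by (auto simp: hom_def Pi_iff D.int_pow_distrib)
qed

text \<open>Since \<open>f\<close> sends \<open>A\<close> into \<open>B\<close>, the factor
  \<open>f a\<close> is absorbed by \<open>B\<close>; conversely \<open>a\<close> is taken to be the
  identity. This removes the choice-free form of \<open>coeff_hom_induced\<close>.\<close>

lemma set_mult_image_coset:
  assumes "comm_group C" "comm_group D" "f \<in> hom C D"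
    and "subgroup A C" "subgroup B D" "f ` A \<subseteq> B" "z \<in> carrier C"
  shows "B <#>\<^bsub>D\<^esub> (f ` (A #>\<^bsub>C\<^esub> z)) = B #>\<^bsub>D\<^esub> f z"
proof -
  interpret C: comm_group C by fact
  interpret D: comm_group D by fact
  interpret f: group_hom C D f
    using assms by unfold_locales (auto simp: group_hom_axioms_def)
  interpret A: subgroup A C by fact
  interpret B: subgroup B D by fact
  have fA: "f a \<in> B" if "a \<in> A" for a
    using assms(6) that by auto
  have eq: "b \<otimes>\<^bsub>D\<^esub> f (a \<otimes>\<^bsub>C\<^esub> z) = (b \<otimes>\<^bsub>D\<^esub> f a) \<otimes>\<^bsub>D\<^esub> f z" if "a \<in> A" "b \<in> B" for a b
    using that assms(7) by (simp add: D.m_assoc)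
  show ?thesis
  proof (intro equalityI subsetI)
    fix x assume "x \<in> B <#>\<^bsub>D\<^esub> (f ` (A #>\<^bsub>C\<^esub> z))"
    then obtain a b where "a \<in> A" "b \<in> B" "x = b \<otimes>\<^bsub>D\<^esub> f (a \<otimes>\<^bsub>C\<^esub> z)"
      by (auto simp: set_mult_def r_coset_def)
    then show "x \<in> B #>\<^bsub>D\<^esub> f z"
      using eq fA by (auto simp: r_coset_def intro!: bexI[of _ "b \<otimes>\<^bsub>D\<^esub> f a"])
  next
    fix x assume "x \<in> B #>\<^bsub>D\<^esub> f z"
    then obtain b where b: "b \<in> B" "x = b \<otimes>\<^bsub>D\<^esub> f z"
      by (auto simp: r_coset_def)
    then have "x = b \<otimes>\<^bsub>D\<^esub> f (\<one>\<^bsub>C\<^esub> \<otimes>\<^bsub>C\<^esub> z)"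
      using assms(7) by simp
    then show "x \<in> B <#>\<^bsub>D\<^esub> (f ` (A #>\<^bsub>C\<^esub> z))"
      using b(1) A.one_closed unfolding set_mult_def r_coset_def by blast
  qed
qed

section \<open>Finitely supported chains and linear extension\<close>

lemma comm_group_sum_group:
  assumes "\<And>i. i \<in> I \<Longrightarrow> comm_group (G i)"
  shows "comm_group (sum_group I G)"
proof (rule group.group_comm_groupI)
  show "group (sum_group I G)"
    using assms by (simp add: comm_group_def)
  have grp: "group (G i)" and mon: "comm_monoid (G i)" if "i \<in> I" for i
    using assms[OF that] by (simp_all add: comm_group_def)
  fix x y assume "x \<in> carrier (sum_group I G)" "y \<in> carrier (sum_group I G)"
  then show "x \<otimes>\<^bsub>sum_group I G\<^esub> y = y \<otimes>\<^bsub>sum_group I G\<^esub> x"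
    by (auto simp: grp carrier_sum_group PiE_iff comm_monoid.m_comm[OF mon] intro: restrict_ext)
qed

context comm_group
begin

lemma carrier_sum_group_const:
  "c \<in> carrier (sum_group A (\<lambda>_. G)) \<longleftrightarrow>
     c \<in> extensional A \<and> (\<forall>\<sigma>\<in>A. c \<sigma> \<in> carrier G) \<and> finite {\<sigma> \<in> A. c \<sigma> \<noteq> \<one>}"
  by (auto simp: carrier_sum_group PiE_iff)

text \<open>The index set in the definition depends on the support of \<open>c\<close>. Enlarging it
  to any finite \<open>F\<close> only adds trivial factors, so several chains can be treated over
  one index set.\<close>

lemma coeff_extend_eq_finprod:
  assumes "c \<in> carrier (sum_group A (\<lambda>_. G))"
    and "finite F" "F \<subseteq> A" "{\<sigma> \<in> A. c \<sigma> \<noteq> \<one>} \<subseteq> F" "\<tau> \<in> B"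
  shows "coeff_extend G m A B c \<tau> = finprod G c {\<sigma> \<in> F. m \<sigma> = \<tau>}"
  unfolding coeff_extend_def restrict_apply using assms
  by (auto simp: carrier_sum_group_const intro!: finprod_mono_neutral_cong_left)

text \<open>Finiteness of the support: a simplex outside the image of the support of
  \<open>c\<close> receives an empty product.\<close>

lemma coeff_extend_closed:
  assumes "c \<in> carrier (sum_group A (\<lambda>_. G))"
  shows "coeff_extend G m A B c \<in> carrier (sum_group B (\<lambda>_. G))"
proof -
  let ?F = "{\<sigma> \<in> A. c \<sigma> \<noteq> \<one>}"
  have fin: "finite ?F" and mem: "\<And>\<sigma>. \<sigma> \<in> A \<Longrightarrow> c \<sigma> \<in> carrier G"
    using assms by (auto simp: carrier_sum_group_const)
  have "coeff_extend G m A B c \<tau> = \<one>" if "\<tau> \<in> B" "\<tau> \<notin> m ` ?F" for \<tau>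
  proof -
    have "{\<sigma> \<in> A. m \<sigma> = \<tau> \<and> c \<sigma> \<noteq> \<one>} = {}" using that by auto
    then show ?thesis using that(1) by (simp only: coeff_extend_def restrict_apply finprod_empty if_True)
  qed
  then have "{\<tau> \<in> B. coeff_extend G m A B c \<tau> \<noteq> \<one>} \<subseteq> m ` ?F"
    by blast
  then have "finite {\<tau> \<in> B. coeff_extend G m A B c \<tau> \<noteq> \<one>}"
    using fin finite_surj by blast
  moreover have "coeff_extend G m A B c \<in> extensional B"
    by (simp add: coeff_extend_def)
  moreover have "coeff_extend G m A B c \<tau> \<in> carrier G" if "\<tau> \<in> B" for \<tau>
    using that mem by (auto simp: coeff_extend_def intro!: finprod_closed)
  ultimately show ?thesis
    by (simp add: carrier_sum_group_const)
qed

lemma coeff_extend_hom: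
  "coeff_extend G m A B \<in> hom (sum_group A (\<lambda>_. G)) (sum_group B (\<lambda>_. G))"
proof (rule homI)
  fix c d assume c: "c \<in> carrier (sum_group A (\<lambda>_. G))" and d: "d \<in> carrier (sum_group A (\<lambda>_. G))"
  \<comment> \<open>A common index set for \<open>c\<close>, \<open>d\<close> and their product,
    whose own support may be smaller through cancellation.\<close>
  let ?F = "{\<sigma> \<in> A. c \<sigma> \<noteq> \<one>} \<union> {\<sigma> \<in> A. d \<sigma> \<noteq> \<one>}"
  let ?cd = "c \<otimes>\<^bsub>sum_group A (\<lambda>_. G)\<^esub> d"
  have grp: "group (sum_group A (\<lambda>_. G))" by (simp add: is_group)
  have cd: "?cd \<in> carrier (sum_group A (\<lambda>_. G))"
    using c d grp by (blast intro: monoid.m_closed group.is_monoid)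
  have F: "finite ?F" "?F \<subseteq> A" and mem: "\<And>\<sigma>. \<sigma> \<in> A \<Longrightarrow> c \<sigma> \<in> carrier G \<and> d \<sigma> \<in> carrier G"
    using c d by (auto simp: carrier_sum_group_const)
  show "coeff_extend G m A B ?cd
      = coeff_extend G m A B c \<otimes>\<^bsub>sum_group B (\<lambda>_. G)\<^esub> coeff_extend G m A B d" (is "?l = ?r")
  proof (rule extensionalityI)
    show "?l \<in> extensional B" "?r \<in> extensional B" by (simp_all add: coeff_extend_def)
    fix \<tau> assume \<tau>: "\<tau> \<in> B"
    have "?l \<tau> = finprod G ?cd {\<sigma> \<in> ?F. m \<sigma> = \<tau>}"
      using F \<tau> by (intro coeff_extend_eq_finprod[OF cd]) auto
    also have "\<dots> = finprod G (\<lambda>\<sigma>. c \<sigma> \<otimes> d \<sigma>) {\<sigma> \<in> ?F. m \<sigma> = \<tau>}"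
      using mem by (intro finprod_cong') auto
    also have "\<dots> = finprod G c {\<sigma> \<in> ?F. m \<sigma> = \<tau>} \<otimes> finprod G d {\<sigma> \<in> ?F. m \<sigma> = \<tau>}"
      using mem by (intro finprod_multf) auto
    also have "\<dots> = ?r \<tau>"
      using coeff_extend_eq_finprod[OF c F _ \<tau>] coeff_extend_eq_finprod[OF d F _ \<tau>] \<tau> by simp
    finally show "?l \<tau> = ?r \<tau>" .
  qed
qed (rule coeff_extend_closed)

text \<open>The fibre of the composite over \<rho> is the disjoint union of the fibres of
  \<open>m\<close> over those \<tau> that \<open>m'\<close> sends to \<rho>, so the iterated product
  collapses to a single one.\<close>

lemma coeff_extend_compose:
  assumes c: "c \<in> carrier (sum_group A (\<lambda>_. G))" and m: "m ` A \<subseteq> B"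
  shows "coeff_extend G m' B C (coeff_extend G m A B c) = coeff_extend G (m' \<circ> m) A C c"
proof (rule extensionalityI)
  fix \<rho> assume \<rho>: "\<rho> \<in> C"
  let ?F = "{\<sigma> \<in> A. c \<sigma> \<noteq> \<one>}"
  let ?I = "{\<tau> \<in> m ` ?F. m' \<tau> = \<rho>}"
  let ?d = "coeff_extend G m A B c"
  have fin: "finite ?F" and mem: "\<And>\<sigma>. \<sigma> \<in> A \<Longrightarrow> c \<sigma> \<in> carrier G"
    using c by (auto simp: carrier_sum_group_const)
  have d: "?d \<tau> = finprod G c {\<sigma> \<in> ?F. m \<sigma> = \<tau>}" if "\<tau> \<in> B" for \<tau>
    using fin that by (intro coeff_extend_eq_finprod[OF c]) auto
  have supp: "{\<tau> \<in> B. ?d \<tau> \<noteq> \<one>} \<subseteq> m ` ?F"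
  proof clarify
    fix \<tau> assume "\<tau> \<in> B" and ne: "?d \<tau> \<noteq> \<one>"
    then have "{\<sigma> \<in> ?F. m \<sigma> = \<tau>} \<noteq> {}" using d by (metis finprod_empty)
    then show "\<tau> \<in> m ` ?F" by blast
  qed
  have "coeff_extend G m' B C ?d \<rho> = finprod G ?d ?I"
    using fin m \<rho> supp by (intro coeff_extend_eq_finprod[OF coeff_extend_closed[OF c]]) auto
  also have "\<dots> = finprod G (\<lambda>\<tau>. finprod G c {\<sigma> \<in> ?F. m \<sigma> = \<tau>}) ?I"
  proof (intro finprod_cong')
    show "?d \<tau> = finprod G c {\<sigma> \<in> ?F. m \<sigma> = \<tau>}" if "\<tau> \<in> ?I" for \<tau>
      using that m by (intro d) auto
  qed (use mem in auto)
  also have "\<dots> = finprod G c (\<Union>\<tau>\<in>?I. {\<sigma> \<in> ?F. m \<sigma> = \<tau>})"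
  proof (intro finprod_UN_disjoint[symmetric])
    show "finite {\<sigma> \<in> ?F. m \<sigma> = \<tau>}" for \<tau>
      using fin by (rule rev_finite_subset) blast
  qed (use fin mem in \<open>auto simp: pairwise_def disjnt_iff\<close>)
  also have "(\<Union>\<tau>\<in>?I. {\<sigma> \<in> ?F. m \<sigma> = \<tau>}) = {\<sigma> \<in> ?F. (m' \<circ> m) \<sigma> = \<rho>}"
    by auto
  also have "finprod G c \<dots> = coeff_extend G (m' \<circ> m) A C c \<rho>"
    using fin \<rho> by (intro coeff_extend_eq_finprod[OF c, symmetric]) auto
  finally show "coeff_extend G m' B C ?d \<rho> = coeff_extend G (m' \<circ> m) A C c \<rho>" .
qed (simp_all add: coeff_extend_def)

lemma coeff_extend_cong:
  assumes "\<And>\<sigma>. \<sigma> \<in> A \<Longrightarrow> m \<sigma> = m' \<sigma>"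
  shows "coeff_extend G m A B = coeff_extend G m' A B"
  using assms by (auto simp: coeff_extend_def fun_eq_iff intro!: arg_cong[of _ _ "finprod G _"])

section \<open>Boundary operators and chain maps\<close>

lemma comm_group_coeff_chain_group: "comm_group (coeff_chain_group G p X)"
  unfolding coeff_chain_group_def by (rule comm_group_sum_group) (rule comm_group_axioms)

lemma coeff_boundary_hom:
  "coeff_boundary G p X \<in> hom (coeff_chain_group G p X) (coeff_chain_group G (p - 1) X)"
proof (cases "p = 0")
  case True
  interpret C: comm_group "coeff_chain_group G 0 X" by (rule comm_group_coeff_chain_group)
  show ?thesis using True by (simp add: coeff_boundary_def hom_def)
next
  case False
  then have "coeff_boundary G p X = (\<lambda>c. finprod (coeff_chain_group G (p - 1) X)
             (\<lambda>i. coeff_extend G (singular_face p i)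
                     (singular_simplex_set p X) (singular_simplex_set (p - 1) X) c
                   [^]\<^bsub>coeff_chain_group G (p - 1) X\<^esub> ((-1) ^ i :: int))
             {..p})"
    by (simp add: coeff_boundary_def fun_eq_iff)
  also have "\<dots> \<in> hom (coeff_chain_group G p X) (coeff_chain_group G (p - 1) X)"
    by (intro finprod_in_hom int_pow_in_hom comm_group_coeff_chain_group)
      (simp add: coeff_chain_group_def coeff_extend_hom)
  finally show ?thesis .
qed

lemma coeff_chain_map_hom:
  "coeff_chain_map G p X Y f \<in> hom (coeff_chain_group G p X) (coeff_chain_group G p Y)"
  by (simp add: coeff_chain_map_def coeff_chain_group_def coeff_extend_hom)

lemma coeff_chain_map_compose:
  assumes "continuous_map X Y f" "c \<in> carrier (coeff_chain_group G p X)"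
  shows "coeff_chain_map G p Y Z g (coeff_chain_map G p X Y f c) = coeff_chain_map G p X Z (g \<circ> f) c"
proof -
  have "simplex_map p f ` singular_simplex_set p X \<subseteq> singular_simplex_set p Y"
    using assms(1) by (auto intro: singular_simplex_simplex_map)
  with assms(2) show ?thesis
    by (simp add: coeff_chain_map_def coeff_chain_group_def coeff_extend_compose simplex_map_compose)
qed

text \<open>Singular simplices take values in \<open>topspace X\<close>, so values of the maps
  elsewhere have no effect. This later replaces \<open>g \<circ> f\<close> by
  \<open>id\<close>.\<close>

lemma coeff_chain_map_cong:
  assumes "\<And>x. x \<in> topspace X \<Longrightarrow> f x = g x"
  shows "coeff_chain_map G p X Y f = coeff_chain_map G p X Y g"
  unfolding coeff_chain_map_def
  by (intro coeff_extend_cong) (auto intro: simplex_map_eq assms)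

text \<open>Taking a face is precomposition and applying \<open>f\<close> is postcomposition, so
  they commute on simplices. Linear extension and the homomorphism property carry this through the
  signs and the sum.\<close>

lemma coeff_chain_map_boundary:
  assumes f: "continuous_map X Y f" and c: "c \<in> carrier (coeff_chain_group G p X)"
  shows "coeff_boundary G p Y (coeff_chain_map G p X Y f c)
       = coeff_chain_map G (p - 1) X Y f (coeff_boundary G p X c)"
proof -
  let ?CX = "coeff_chain_group G (p - 1) X" and ?CY = "coeff_chain_group G (p - 1) Y"
  let ?f = "coeff_chain_map G (p - 1) X Y f"
  interpret CX: comm_group ?CX by (rule comm_group_coeff_chain_group)
  interpret CY: comm_group ?CY by (rule comm_group_coeff_chain_group)
  interpret f: group_hom ?CX ?CY ?f
    using coeff_chain_map_hom by unfold_locales (auto simp: group_hom_axioms_def)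
  show ?thesis
  proof (cases "p = 0")
    case True
    \<comment> \<open>In degree 0 both sides are the trivial chain, since \<open>p - 1\<close> is
      again 0.\<close>
    then show ?thesis using f.hom_one by (simp add: coeff_boundary_def)
  next
    case False
    define DX where "DX i = coeff_extend G (singular_face p i)
        (singular_simplex_set p X) (singular_simplex_set (p - 1) X)" for i
    define DY where "DY i = coeff_extend G (singular_face p i)
        (singular_simplex_set p Y) (singular_simplex_set (p - 1) Y)" for i
    have DX: "DX i c \<in> carrier ?CX" for i
      using c by (simp add: DX_def coeff_chain_group_def coeff_extend_closed)
    have face: "DY i (coeff_chain_map G p X Y f c) = ?f (DX i c)" if "i \<le> p" for i
    proof -
      have 1: "simplex_map p f ` singular_simplex_set p X \<subseteq> singular_simplex_set p Y"
        using f by (auto intro: singular_simplex_simplex_map)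
      have 2: "singular_face p i ` singular_simplex_set p X \<subseteq> singular_simplex_set (p - 1) X"
        using False that by (auto intro: singular_simplex_singular_face)
      \<comment> \<open>The restrictions to standard simplices agree because the face map sends the
        simplex of dimension \<open>p - 1\<close> into that of dimension \<open>p\<close>.\<close>
      have 3: "singular_face p i \<circ> simplex_map p f = simplex_map (p - 1) f \<circ> singular_face p i"
        using False that simplical_face_in_standard_simplex[of p i]
        by (auto simp: singular_face_def simplex_map_def fun_eq_iff restrict_def)
      show ?thesis
        using c by (simp add: DX_def DY_def coeff_chain_map_def coeff_chain_group_def
            coeff_extend_compose[OF _ 1] coeff_extend_compose[OF _ 2, simplified] 3)
    qed
    have "coeff_boundary G p Y (coeff_chain_map G p X Y f c)
        = finprod ?CY (\<lambda>i. DY i (coeff_chain_map G p X Y f c) [^]\<^bsub>?CY\<^esub> ((-1) ^ i :: int)) {..p}"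
      using False by (simp add: coeff_boundary_def DY_def)
    also have "\<dots> = finprod ?CY (\<lambda>i. ?f (DX i c [^]\<^bsub>?CX\<^esub> ((-1) ^ i :: int))) {..p}"
      using DX by (intro CY.finprod_cong') (auto simp: face f.hom_int_pow simp del: One_nat_def)
    also have "\<dots> = ?f (finprod ?CX (\<lambda>i. DX i c [^]\<^bsub>?CX\<^esub> ((-1) ^ i :: int)) {..p})"
      using DX
      by (intro hom_finprod[OF CX.comm_group_axioms CY.comm_group_axioms f.homh, symmetric])
        (auto simp del: One_nat_def)
    also have "\<dots> = ?f (coeff_boundary G p X c)"
      using False by (simp add: coeff_boundary_def DX_def)
    finally show ?thesis .
  qed
qed

lemma group_hom_coeff_boundary:
  "group_hom (coeff_chain_group G p X) (coeff_chain_group G (p - 1) X) (coeff_boundary G p X)"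
  by (intro group_hom.intro group_hom_axioms.intro coeff_boundary_hom
      comm_group.axioms(2) comm_group_coeff_chain_group)

lemma group_hom_coeff_chain_map:
  "group_hom (coeff_chain_group G p X) (coeff_chain_group G p Y) (coeff_chain_map G p X Y f)"
  by (intro group_hom.intro group_hom_axioms.intro coeff_chain_map_hom
      comm_group.axioms(2) comm_group_coeff_chain_group)

section \<open>Cycles, boundaries and homology classes\<close>

lemma subgroup_coeff_cycles: "subgroup (coeff_cycles G p X) (coeff_chain_group G p X)"
  unfolding coeff_cycles_def by (rule group_hom.subgroup_kernel[OF group_hom_coeff_boundary])

lemma subgroup_coeff_boundaries: "subgroup (coeff_boundaries G p X) (coeff_chain_group G p X)"
  using group_hom.img_is_subgroup[OF group_hom_coeff_boundary[of "Suc p" X]]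
  by (simp add: coeff_boundaries_def)

lemma coeff_chain_map_cycles:
  assumes "continuous_map X Y f"
  shows "coeff_chain_map G p X Y f ` coeff_cycles G p X \<subseteq> coeff_cycles G p Y"
  using assms group_hom.hom_one[OF group_hom_coeff_chain_map, of "p - 1" X Y f]
    hom_carrier[OF coeff_chain_map_hom, of p X Y f]
  by (auto simp: coeff_cycles_def kernel_def coeff_chain_map_boundary)

lemma coeff_chain_map_boundaries:
  assumes "continuous_map X Y f"
  shows "coeff_chain_map G p X Y f ` coeff_boundaries G p X \<subseteq> coeff_boundaries G p Y"
  using hom_carrier[OF coeff_chain_map_hom, of "Suc p" X Y f]
    coeff_chain_map_boundary[OF assms, of _ "Suc p"]
  by (force simp: coeff_boundaries_def)


text \<open>An instance of \<open>set_mult_image_coset\<close>, as boundaries go to boundaries. It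
  covers all chains \<open>z\<close>, matching the use of cosets in the whole chain group.\<close>

lemma coeff_hom_induced_coset:
  assumes "0 \<le> k" "continuous_map X Y f" "z \<in> carrier (coeff_chain_group G (nat k) X)"
  shows "coeff_hom_induced G k X Y f
           (coeff_boundaries G (nat k) X #>\<^bsub>coeff_chain_group G (nat k) X\<^esub> z)
       = coeff_boundaries G (nat k) Y #>\<^bsub>coeff_chain_group G (nat k) Y\<^esub>
           coeff_chain_map G (nat k) X Y f z"
  using assms unfolding coeff_hom_induced_def
  by (simp add: set_mult_image_coset comm_group_coeff_chain_group coeff_chain_map_hom
      subgroup_coeff_boundaries coeff_chain_map_boundaries)

text \<open>
  Homology is treated as a subset of the quotient of the whole chain group, rather than of the cycles,
  by the boundaries. There the boundaries are a normal subgroup without appeal to the vanishing of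
  the composite of two boundary maps, which is therefore never proved.
\<close>

lemma coeff_homology_group_nonneg:
  assumes "0 \<le> k"
  shows "coeff_homology_group G k X =
    (coeff_chain_group G (nat k) X Mod coeff_boundaries G (nat k) X)
      \<lparr>carrier := (#>\<^bsub>coeff_chain_group G (nat k) X\<^esub>) (coeff_boundaries G (nat k) X)
                     ` coeff_cycles G (nat k) X\<rparr>"
  \<comment> \<open>Cosets and their products involve only the multiplication, so restricting the
    carrier to the cycles changes neither.\<close>
  using assms
  by (auto simp: coeff_homology_group_def FactGroup_def RCOSETS_def r_coset_def set_mult_def
      fun_eq_iff)

text \<open>The set is the image of \<open>T\<close> under the quotient projection. In the
  application \<open>T\<close> consists of cycles pushed forward from another space and may fail to
  contain the boundaries.\<close>

lemma subgroup_coeff_cosets: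
  assumes "subgroup T (coeff_chain_group G p X)"
  shows "subgroup ((#>\<^bsub>coeff_chain_group G p X\<^esub>) (coeff_boundaries G p X) ` T)
           (coeff_chain_group G p X Mod coeff_boundaries G p X)"
proof -
  interpret C: comm_group "coeff_chain_group G p X" by (rule comm_group_coeff_chain_group)
  interpret N: normal "coeff_boundaries G p X" "coeff_chain_group G p X"
    by (rule C.subgroup_imp_normal) (rule subgroup_coeff_boundaries)
  interpret q: group_hom "coeff_chain_group G p X" "coeff_chain_group G p X Mod coeff_boundaries G p X"
      "(#>\<^bsub>coeff_chain_group G p X\<^esub>) (coeff_boundaries G p X)"
    by (intro group_hom.intro group_hom_axioms.intro N.r_coset_hom_Mod N.factorgroup_is_group
        C.is_group)
  show ?thesis by (rule q.subgroup_img_is_subgroup[OF assms])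
qed

lemma subgroup_coeff_cycles_image:
  "subgroup (coeff_chain_map G p X Y f ` coeff_cycles G p X) (coeff_chain_group G p Y)"
  by (rule group_hom.subgroup_img_is_subgroup[OF group_hom_coeff_chain_map subgroup_coeff_cycles])

lemma coeff_cycles_closed: "z \<in> coeff_cycles G p X \<Longrightarrow> z \<in> carrier (coeff_chain_group G p X)"
  by (simp add: coeff_cycles_def kernel_def)

lemma coeff_hom_induced_cycles_image:
  assumes "0 \<le> k" "continuous_map X Y f"
  shows "coeff_hom_induced G k X Y f ` carrier (coeff_homology_group G k X) =
    (#>\<^bsub>coeff_chain_group G (nat k) Y\<^esub>) (coeff_boundaries G (nat k) Y)
      ` coeff_chain_map G (nat k) X Y f ` coeff_cycles G (nat k) X"
  using assms
  by (simp add: coeff_homology_group_nonneg image_image coeff_hom_induced_coset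
      coeff_cycles_closed cong: image_cong_simp)

section \<open>Sublevel sets and persistent homology groups\<close>

lemma continuous_map_sublevel:
  assumes "continuous_map X Y f" "\<And>x. x \<in> topspace X \<Longrightarrow> \<phi> x \<le> u \<Longrightarrow> \<psi> (f x) \<le> v"
  shows "continuous_map (sublevel X \<phi> u) (sublevel Y \<psi> v) f"
  using assms unfolding sublevel_def
  by (auto simp: continuous_map_in_subtopology continuous_map_from_subtopology
      dest: continuous_map_funspace)

lemma topspace_sublevel: "topspace (sublevel X \<phi> u) = {x \<in> topspace X. \<phi> x \<le> u}"
  by (auto simp: sublevel_def)

text \<open>Presents the group inside the quotient of the chains of the upper sublevel set, so that
  subgroups and homomorphisms can be handled on representatives.\<close>

lemma persistent_homology_nonneg:
  fixes \<phi> :: "'x \<Rightarrow> real ^ 'n"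
  assumes "0 \<le> k" "u \<le> v"
  shows "persistent_homology G k X \<phi> u v =
    (coeff_chain_group G (nat k) (sublevel X \<phi> v) Mod coeff_boundaries G (nat k) (sublevel X \<phi> v))
      \<lparr>carrier := (#>\<^bsub>coeff_chain_group G (nat k) (sublevel X \<phi> v)\<^esub>)
                      (coeff_boundaries G (nat k) (sublevel X \<phi> v))
         ` coeff_chain_map G (nat k) (sublevel X \<phi> u) (sublevel X \<phi> v) id
         ` coeff_cycles G (nat k) (sublevel X \<phi> u)\<rparr>"
proof -
  have "continuous_map (sublevel X \<phi> u) (sublevel X \<phi> v) id"
    using assms(2) by (intro continuous_map_sublevel) auto
  with assms(1) show ?thesis
    unfolding persistent_homology_def
    by (simp add: coeff_hom_induced_cycles_image) (simp add: coeff_homology_group_nonneg)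
qed

lemma persistent_homology_neg:
  assumes "k < 0"
  shows "persistent_homology G k X \<phi> u v = singleton_group undefined"
  using assms
  by (simp add: persistent_homology_def coeff_homology_group_def coeff_hom_induced_def
      singleton_group_def)

text \<open>
  The inclusion of the two outer sublevel sets of \<open>X\<close> factors through the inclusion of the two
  inner ones of \<open>Y\<close>; the subgroup is the image in the homology of the upper sublevel set of \<open>Y\<close> of the
  homology of the lower one of \<open>X\<close>, and the surjection is induced by \<open>g\<close>.
\<close>

lemma subgroup_surjects_persistent_homology:
  fixes \<phi> :: "'x \<Rightarrow> real ^ 'n" and \<psi> :: "'y \<Rightarrow> real ^ 'n"
  assumes f: "continuous_map X Y f" and g: "continuous_map Y X g"
    and gf: "\<And>x. x \<in> topspace X \<Longrightarrow> g (f x) = x"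
    and uv: "u \<le> v" and uv': "u' \<le> v'"
    and fu: "\<And>x. x \<in> topspace X \<Longrightarrow> \<phi> x \<le> u' \<Longrightarrow> \<psi> (f x) \<le> u"
    and gv: "\<And>y. y \<in> topspace Y \<Longrightarrow> \<psi> y \<le> v \<Longrightarrow> \<phi> (g y) \<le> v'"
  shows "subgroup_surjects (persistent_homology G k Y \<psi> u v) (persistent_homology G k X \<phi> u' v')"
proof (cases "0 \<le> k")
  case False
  \<comment> \<open>In negative degrees both groups are trivial, and the constant map is the
    required surjection.\<close>
  have "subgroup {undefined} (singleton_group undefined :: (((nat \<Rightarrow> real) \<Rightarrow> 'y) \<Rightarrow> 'a) set monoid)"
    using group.subgroup_self[OF singleton_group] by simp
  then show ?thesis
    using False unfolding subgroup_surjects_def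
    by (intro exI[of _ "{undefined}"] exI[of _ "\<lambda>_. undefined"])
      (auto simp: persistent_homology_neg epi_def hom_def singleton_group_def)
next
  case k: True
  define p where "p = nat k"
  let ?Xu = "sublevel X \<phi> u'" and ?Xv = "sublevel X \<phi> v'"
  let ?Yu = "sublevel Y \<psi> u" and ?Yv = "sublevel Y \<psi> v"
  let ?CX = "coeff_chain_group G p ?Xv" and ?CY = "coeff_chain_group G p ?Yv"
  let ?BX = "coeff_boundaries G p ?Xv" and ?BY = "coeff_boundaries G p ?Yv"
  let ?QX = "?CX Mod ?BX" and ?QY = "?CY Mod ?BY"
  let ?Z = "coeff_cycles G p ?Xu"
  let ?f = "coeff_chain_map G p ?Xu ?Yv f"
  let ?g = "coeff_chain_map G p ?Yv ?Xv g"
  let ?S = "(#>\<^bsub>?CY\<^esub>) ?BY ` ?f ` ?Z"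
  let ?PY = "(#>\<^bsub>?CY\<^esub>) ?BY ` coeff_chain_map G p ?Yu ?Yv id ` coeff_cycles G p ?Yu"
  let ?PX = "(#>\<^bsub>?CX\<^esub>) ?BX ` coeff_chain_map G p ?Xu ?Xv id ` ?Z"
  let ?h = "coeff_hom_induced G k ?Yv ?Xv g"
  have contu: "continuous_map ?Xu ?Yu f" and contuv: "continuous_map ?Xu ?Yv f"
    and contv: "continuous_map ?Yv ?Xv g"
    using f g fu gv uv by (auto intro!: continuous_map_sublevel intro: order_trans)
  have PY: "persistent_homology G k Y \<psi> u v = ?QY\<lparr>carrier := ?PY\<rparr>"
    and PX: "persistent_homology G k X \<phi> u' v' = ?QX\<lparr>carrier := ?PX\<rparr>"
    using k uv uv' by (simp_all add: persistent_homology_nonneg p_def)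
  interpret CX: comm_group ?CX by (rule comm_group_coeff_chain_group)
  interpret CY: comm_group ?CY by (rule comm_group_coeff_chain_group)
  interpret NX: normal ?BX ?CX
    by (rule CX.subgroup_imp_normal) (rule subgroup_coeff_boundaries)
  interpret NY: normal ?BY ?CY
    by (rule CY.subgroup_imp_normal) (rule subgroup_coeff_boundaries)
  have f_closed: "?f z \<in> carrier ?CY" if "z \<in> ?Z" for z
    using hom_in_carrier[OF coeff_chain_map_hom coeff_cycles_closed[OF that]] .
  have h: "?h (?BY #>\<^bsub>?CY\<^esub> c) = ?BX #>\<^bsub>?CX\<^esub> ?g c" if "c \<in> carrier ?CY" for c
    using coeff_hom_induced_coset[OF k contv] that by (simp add: p_def)
  have gf_chain: "?g (?f z) = coeff_chain_map G p ?Xu ?Xv id z" if "z \<in> ?Z" for z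
  proof -
    have "?g (?f z) = coeff_chain_map G p ?Xu ?Xv (g \<circ> f) z"
      by (rule coeff_chain_map_compose[OF contuv coeff_cycles_closed[OF that]])
    also have "coeff_chain_map G p ?Xu ?Xv (g \<circ> f) = coeff_chain_map G p ?Xu ?Xv id"
      by (rule coeff_chain_map_cong) (simp add: topspace_sublevel gf)
    finally show ?thesis .
  qed
  \<comment> \<open>\<open>f\<close> already lands in the lower sublevel set of \<open>Y\<close>, so
    its pushed cycles factor through cycles there.\<close>
  have "?f z \<in> coeff_chain_map G p ?Yu ?Yv id ` coeff_cycles G p ?Yu" if "z \<in> ?Z" for z
  proof
    show "coeff_chain_map G p ?Xu ?Yu f z \<in> coeff_cycles G p ?Yu"
      using coeff_chain_map_cycles[OF contu] that by blast
    show "?f z = coeff_chain_map G p ?Yu ?Yv id (coeff_chain_map G p ?Xu ?Yu f z)"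
      by (simp add: coeff_chain_map_compose[OF contu coeff_cycles_closed[OF that]])
  qed
  then have "?S \<subseteq> ?PY" by blast
  then have S: "subgroup ?S (?QY\<lparr>carrier := ?PY\<rparr>)"
    by (intro group.subgroup_incl[OF NY.factorgroup_is_group] subgroup_coeff_cosets
        subgroup_coeff_cycles_image)
  \<comment> \<open>Gives both that \<open>?h\<close> maps into the target and that it is
    onto.\<close>
  have image_h: "?h ` ?S = ?PX"
    by (simp add: image_image h f_closed gf_chain cong: image_cong_simp)
  have "?h \<in> hom (?QY\<lparr>carrier := ?S\<rparr>) (?QX\<lparr>carrier := ?PX\<rparr>)"
  proof (rule homI)
    show "?h s \<in> carrier (?QX\<lparr>carrier := ?PX\<rparr>)" if "s \<in> carrier (?QY\<lparr>carrier := ?S\<rparr>)" for s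
      using imageI[of s ?S ?h] that unfolding image_h by simp
    fix s t assume "s \<in> carrier (?QY\<lparr>carrier := ?S\<rparr>)" "t \<in> carrier (?QY\<lparr>carrier := ?S\<rparr>)"
    then obtain c d where c: "c \<in> carrier ?CY" "s = ?BY #>\<^bsub>?CY\<^esub> c"
      and d: "d \<in> carrier ?CY" "t = ?BY #>\<^bsub>?CY\<^esub> d"
      using f_closed by auto
    have "?h (s <#>\<^bsub>?CY\<^esub> t) = ?BX #>\<^bsub>?CX\<^esub> ?g (c \<otimes>\<^bsub>?CY\<^esub> d)"
      using c d by (simp only: NY.rcos_sum h CY.m_closed)
    also have "\<dots> = ?BX #>\<^bsub>?CX\<^esub> (?g c \<otimes>\<^bsub>?CX\<^esub> ?g d)"
      using c d by (simp only: hom_mult[OF coeff_chain_map_hom])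
    also have "\<dots> = ?h s <#>\<^bsub>?CX\<^esub> ?h t"
      using c d by (simp only: NX.rcos_sum h hom_in_carrier[OF coeff_chain_map_hom])
    finally show "?h (s \<otimes>\<^bsub>?QY\<lparr>carrier := ?S\<rparr>\<^esub> t) = ?h s \<otimes>\<^bsub>?QX\<lparr>carrier := ?PX\<rparr>\<^esub> ?h t"
      by simp
  qed
  with image_h have "?h \<in> epi (?QY\<lparr>carrier := ?PY, carrier := ?S\<rparr>) (?QX\<lparr>carrier := ?PX\<rparr>)"
    by (simp add: epi_def)
  with S show ?thesis
    unfolding subgroup_surjects_def PX PY by blast
qed

end

section \<open>Comparison of the two distances\<close>

theorem theorem2p8:
  fixes X :: "'a topology" and Y :: "'b topology"
    and \<phi> :: "'a \<Rightarrow> real ^ 'n" and \<psi> :: "'b \<Rightarrow> real ^ 'n"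
    and k :: int and G :: "('g, 'm) monoid_scheme"
  assumes "compact_space X" and "compact_space Y"
    and "continuous_map X euclidean \<phi>" and "continuous_map Y euclidean \<psi>"
    and "comm_group G"
  shows "dist_T (persistent_homology G k X \<phi>) (persistent_homology G k Y \<psi>)
           \<le> natural_pseudodistance X \<phi> Y \<psi>"
  unfolding natural_pseudodistance_def
proof (rule INF_greatest)
  fix f assume "f \<in> {h. homeomorphic_map X Y h}"
  then obtain g where fg: "homeomorphic_maps X Y f g"
    by (auto simp: homeomorphic_map_maps)
  then have f: "continuous_map X Y f" and g: "continuous_map Y X g"
    and gf: "\<And>x. x \<in> topspace X \<Longrightarrow> g (f x) = x" and fg: "\<And>y. y \<in> topspace Y \<Longrightarrow> f (g y) = y"
    by (auto simp: homeomorphic_maps_def)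
  let ?s = "sup_norm X (\<lambda>x. \<phi> x - \<psi> (f x))"
  show "dist_T (persistent_homology G k X \<phi>) (persistent_homology G k Y \<psi>) \<le> ?s"
  proof (cases "?s")
    \<comment> \<open>The admissible shift is the sup norm itself; an infinite value makes the bound
      trivial.\<close>
    case (real \<epsilon>)
    have near: "\<bar>\<phi> x $ i - \<psi> (f x) $ i\<bar> \<le> \<epsilon>" if "x \<in> topspace X" for x i
    proof -
      have "ennreal (infnorm (\<phi> x - \<psi> (f x))) \<le> ?s"
        unfolding sup_norm_def using that by (rule SUP_upper)
      then have "infnorm (\<phi> x - \<psi> (f x)) \<le> \<epsilon>"
        using real by simp
      then show ?thesis
        using component_le_infnorm_cart[of "\<phi> x - \<psi> (f x)" i] by simp
    qed
    have near': "\<bar>\<phi> (g y) $ i - \<psi> y $ i\<bar> \<le> \<epsilon>" if "y \<in> topspace Y" for y i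
      using near[of "g y" i] that fg continuous_map_funspace[OF g] by (auto simp: Pi_iff)
    have vec_leI: "a \<le> w" if "\<And>i. a $ i \<le> w $ i" for a w :: "real ^ 'n"
      using that by (simp add: less_eq_vec_def)
    have "subgroup_surjects (persistent_homology G k X \<phi> u v)
            (persistent_homology G k Y \<psi> (u - (\<chi> i. \<epsilon>)) (v + (\<chi> i. \<epsilon>))) \<and>
          subgroup_surjects (persistent_homology G k Y \<psi> u v)
            (persistent_homology G k X \<phi> (u - (\<chi> i. \<epsilon>)) (v + (\<chi> i. \<epsilon>)))"
      if uv: "u \<prec> v" for u v :: "real ^ 'n"
    proof -
      have le: "u \<le> v" "u - (\<chi> i. \<epsilon>) \<le> v + (\<chi> i. \<epsilon>)"
        using uv real(1) by (auto simp: strictly_below_def less_imp_le intro!: vec_leI)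
          (smt (verit))
      have X_down: "\<psi> (f x) \<le> u" if "x \<in> topspace X" "\<phi> x \<le> u - (\<chi> i. \<epsilon>)" for x and u :: "real ^ 'n"
        using that near[OF that(1)]
        unfolding less_eq_vec_def vector_minus_component vector_add_component vec_lambda_beta
        by (smt (verit))
      have X_up: "\<psi> (f x) \<le> v + (\<chi> i. \<epsilon>)" if "x \<in> topspace X" "\<phi> x \<le> v" for x and v :: "real ^ 'n"
        using that near[OF that(1)]
        unfolding less_eq_vec_def vector_minus_component vector_add_component vec_lambda_beta
        by (smt (verit))
      have Y_down: "\<phi> (g y) \<le> u" if "y \<in> topspace Y" "\<psi> y \<le> u - (\<chi> i. \<epsilon>)" for y and u :: "real ^ 'n"
        using that near'[OF that(1)]
        unfolding less_eq_vec_def vector_minus_component vector_add_component vec_lambda_beta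
        by (smt (verit))
      have Y_up: "\<phi> (g y) \<le> v + (\<chi> i. \<epsilon>)" if "y \<in> topspace Y" "\<psi> y \<le> v" for y and v :: "real ^ 'n"
        using that near'[OF that(1)]
        unfolding less_eq_vec_def vector_minus_component vector_add_component vec_lambda_beta
        by (smt (verit))
      \<comment> \<open>The first condition uses \<open>g\<close> as the inner map and
        \<open>f\<close> as the outer one, with \<open>Y_down\<close> and \<open>X_up\<close>; the
        second exchanges them, with \<open>X_down\<close> and \<open>Y_up\<close>.\<close>
      show ?thesis
        using assms(5) f g fg gf le X_down X_up Y_down Y_up
        by (intro conjI comm_group.subgroup_surjects_persistent_homology[of G Y X g f]
            comm_group.subgroup_surjects_persistent_homology[of G X Y f g]) auto
    qed
    then have "dist_T (persistent_homology G k X \<phi>) (persistent_homology G k Y \<psi>) \<le> ennreal \<epsilon>"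
      unfolding dist_T_def using real(1) by (intro INF_lower) auto
    with real show ?thesis by simp
  qed simp
qed

end
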